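(* For every integer $n\geq 0$, \[ \binom{2n}{n}=\sum_{k=0}^{n}\frac{2k+1}{2n+1}\binom{2n+1}{n-k}P_k(x)(1-x)^{n-k}. \]
   Context: For $k\geq 0$, $P_k(x)=\sum_{j=0}^{k}\binom{k}{j}^2x^j$ denotes the type $B$ Narayana polynomial (so $P_0(x)=1$). *)

theory Defs
  imports "HOL-Computational_Algebra.Polynomial"
begin

definition narayana_B :: "nat \<Rightarrow> 'a::comm_semiring_1 poly" where
  "narayana_B k = (\<Sum>j=0..k. monom (of_nat ((k choose j)\<^sup>2)) j)"

end

(* Expanding P_k in powers of y = 1 - x turns the right-hand side into
   sum_j binom(2j,j) c_j y^(n-j), where (2n+1) c_j is the alternating sum over k of
   (2k+1) binom(2n+1,n-k) binom(k+j,2j). That sum is Gosper-summable in k, and its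
   closed form shows that c_j = 0 for j < n, while c_n = 1. *)

theory Submission imports Defs begin

text \<open>This is the coefficient of (x - 1)^i in P_k, since x^j is the sum of binom(j,i) (x -
  1)^i. Trading binom(k,j) binom(j,i) for binom(k,i) binom(k-i,k-j) frees the factor binom(k,i) and
  leaves a Vandermonde convolution.\<close>

lemma sum_choose_square_mult_choose:
  assumes "i \<le> k"
  shows "(\<Sum>j\<le>k. (k choose j)\<^sup>2 * (j choose i)) = (k choose i) * ((2 * k - i) choose k)"
proof -
  have "(\<Sum>j\<le>k. (k choose j)\<^sup>2 * (j choose i)) = (\<Sum>j\<in>{i..k}. (k choose j)\<^sup>2 * (j choose i))"
    by (rule sum.mono_neutral_right) (auto simp: binomial_eq_0)
  also have "\<dots> = (\<Sum>j\<in>{i..k}. (k choose i) * ((k choose j) * ((k - i) choose (k - j))))"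
  proof (intro sum.cong refl)
    fix j assume j: "j \<in> {i..k}"
    have "(k choose j) * (j choose i) = (k choose i) * ((k - i) choose (j - i))"
      using j by (intro choose_mult) auto
    moreover have "(k - i) choose (j - i) = (k - i) choose (k - j)"
      using j binomial_symmetric[of "j - i" "k - i"] by auto
    ultimately show "(k choose j)\<^sup>2 * (j choose i) = (k choose i) * ((k choose j) * ((k - i) choose (k - j)))"
      by (simp add: power2_eq_square)
  qed
  also have "\<dots> = (k choose i) * (\<Sum>j\<le>k. (k choose j) * ((k - i) choose (k - j)))"
    unfolding sum_distrib_left
    by (rule sum.mono_neutral_left) (use assms in \<open>auto simp: binomial_eq_0\<close>)
  also have "(\<Sum>j\<le>k. (k choose j) * ((k - i) choose (k - j))) = (k + (k - i)) choose k"
    by (rule vandermonde)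
  finally show ?thesis
    using assms by (simp add: mult_2)
qed

text \<open>Both sides are the multinomial (k+j)! / (j! j! (k-j)!). The right-hand form isolates a
  factor free of \<open>k\<close>, which can leave the later sum over \<open>k\<close>.\<close>

lemma choose_mult_choose_add:
  assumes "j \<le> k"
  shows "(k choose j) * ((k + j) choose k) = ((2 * j) choose j) * ((k + j) choose (2 * j))"
proof -
  have "((k + j) choose k) * (k choose j) = ((k + j) choose j) * (k choose (k - j))"
    using choose_mult[of j k "k + j"] assms by (simp add: binomial_symmetric[of j k])
  moreover have "((k + j) choose (2 * j)) * ((2 * j) choose j) = ((k + j) choose j) * (k choose j)"
    using choose_mult[of j "2 * j" "k + j"] assms by (simp add: mult_2)
  ultimately show ?thesis
    using assms by (simp add: binomial_symmetric[of j k] mult.commute)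
qed

lemma smult_sum_right: "smult a (sum f S) = (\<Sum>i\<in>S. smult a (f i))"
  by (induction S rule: infinite_finite_induct) (simp_all add: smult_add_right)

lemma narayana_B_expansion:
  "narayana_B k = (\<Sum>j\<le>k. smult (of_nat (((2 * j) choose j) * ((k + j) choose (2 * j))))
     ((- [:1, -1:]) ^ (k - j)) :: 'a::comm_ring_1 poly)"
proof -
  define z :: "'a poly" where "z = - [:1, -1:]"
  have monom_z: "monom (1::'a) 1 ^ j = (\<Sum>i\<le>k. of_nat (j choose i) * z ^ i)" if "j \<le> k" for j
  proof -
    have "monom (1::'a) 1 = z + 1"
      by (simp add: z_def monom_altdef one_pCons)
    then have "monom (1::'a) 1 ^ j = (\<Sum>i\<le>j. of_nat (j choose i) * z ^ i)"
      by (simp add: binomial_ring)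
    also have "\<dots> = (\<Sum>i\<le>k. of_nat (j choose i) * z ^ i)"
      by (rule sum.mono_neutral_left) (use that in \<open>auto simp: binomial_eq_0\<close>)
    finally show ?thesis .
  qed
  have "narayana_B k = (\<Sum>j\<le>k. of_nat ((k choose j)\<^sup>2) * monom (1::'a) 1 ^ j)"
    unfolding narayana_B_def atLeast0AtMost
    by (intro sum.cong refl) (simp add: monom_altdef of_nat_poly del: of_nat_power)
  also have "\<dots> = (\<Sum>j\<le>k. \<Sum>i\<le>k. of_nat ((k choose j)\<^sup>2 * (j choose i)) * z ^ i)"
    by (intro sum.cong refl) (simp only: atMost_iff monom_z sum_distrib_left of_nat_mult mult.assoc)
  also have "\<dots> = (\<Sum>i\<le>k. \<Sum>j\<le>k. of_nat ((k choose j)\<^sup>2 * (j choose i)) * z ^ i)"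
    by (rule sum.swap)
  also have "\<dots> = (\<Sum>i\<le>k. of_nat ((k choose i) * ((2 * k - i) choose k)) * z ^ i)"
    by (intro sum.cong refl)
       (simp only: sum_distrib_right[symmetric] of_nat_sum[symmetric] sum_choose_square_mult_choose atMost_iff)
  \<comment> \<open>Reversing the order of summation makes the exponent \<open>k - j\<close>, so
    that a further factor y^(n-k) will give y^(n-j), whatever \<open>k\<close> is.\<close>
  also have "\<dots> = (\<Sum>j\<le>k. of_nat ((k choose (k - j)) * ((2 * k - (k - j)) choose k)) * z ^ (k - j))"
    by (rule sum.nat_diff_reindex[symmetric, of _ "Suc k", unfolded lessThan_Suc_atMost, simplified])
  also have "\<dots> = (\<Sum>j\<le>k. smult (of_nat (((2 * j) choose j) * ((k + j) choose (2 * j)))) (z ^ (k - j)))"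
  proof (intro sum.cong refl)
    fix j assume "j \<in> {..k}"
    then have "(k choose (k - j)) * ((2 * k - (k - j)) choose k) = (k choose j) * ((k + j) choose k)"
      by (simp add: binomial_symmetric[of j k] mult_2)
    then show "of_nat ((k choose (k - j)) * ((2 * k - (k - j)) choose k)) * z ^ (k - j) =
        smult (of_nat (((2 * j) choose j) * ((k + j) choose (2 * j)))) (z ^ (k - j))"
      using \<open>j \<in> {..k}\<close> by (simp only: atMost_iff choose_mult_choose_add) (simp add: of_nat_poly)
  qed
  finally show ?thesis
    by (simp only: z_def)
qed

(* The closed form was found by Gosper's algorithm. *)
lemma alternating_ballot_sum:
  assumes "m \<le> n"
  shows "(of_nat n - of_nat j) * (\<Sum>k\<le>m. (-1) ^ k * of_nat (2 * k + 1) *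
           of_nat ((2 * n + 1) choose (n - k)) * of_nat ((k + j) choose (2 * j))) =
         (-1) ^ m * of_nat (m + j + 1) * of_nat ((m + j) choose (2 * j)) *
           of_nat (n - m) * (of_nat ((2 * n + 1) choose (n - m)) :: 'a::comm_ring_1)"
  using assms
proof (induction m)
  case 0
  show ?case
    by (cases "j = 0") (simp_all add: binomial_eq_0)
next
  case (Suc m)
  define A B C D :: 'a where
    "A = of_nat ((2 * n + 1) choose (n - m))" and
    "B = of_nat ((2 * n + 1) choose (n - Suc m))" and
    "C = of_nat ((m + j) choose (2 * j))" and
    "D = of_nat ((Suc m + j) choose (2 * j))"
  \<comment> \<open>Ratio of neighbouring binomials: with d = n - m - 1, both sides equal (2n+1)
    binom(2n,d) by absorption.\<close>
  have "(n - m) * ((2 * n + 1) choose (n - m)) = (n + m + 2) * ((2 * n + 1) choose (n - Suc m))"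
  proof -
    from Suc.prems obtain d where n: "n = m + Suc d"
      by (metis Suc_le_D add_Suc_right add_Suc le_iff_add)
    have "Suc d * ((2 * n + 1) choose Suc d) = (2 * n + 1 - d) * ((2 * n + 1) choose d)"
      by (simp only: binomial_absorption binomial_absorb_comp)
    moreover have "n - m = Suc d" "n - Suc m = d" "2 * n + 1 - d = n + m + 2"
      by (simp_all add: n)
    ultimately show ?thesis
      by (simp only:)
  qed
  then have AB: "(of_nat n - of_nat m) * A = (of_nat n + of_nat m + 2) * B"
    using Suc.prems unfolding A_def B_def
    by (metis (no_types, lifting) Suc_leD of_nat_add of_nat_diff of_nat_mult of_nat_numeral)
  \<comment> \<open>The ratio of the other binomial in the summand. For j > m + 1 the subtraction
    \<open>Suc m - j\<close> truncates, but then \<open>C\<close> and \<open>D\<close> both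
    vanish.\<close>
  have CD: "(of_nat m + of_nat j + 1) * C = (of_nat m + 1 - of_nat j) * D"
  proof (cases "j \<le> Suc m")
    case True
    have "(m + j + 1) * ((m + j) choose (2 * j)) = (Suc m - j) * ((Suc m + j) choose (2 * j))"
      using binomial_absorb_comp[of "Suc m + j" "2 * j"] True by simp
    then have "(of_nat ((m + j + 1) * ((m + j) choose (2 * j))) :: 'a) =
        of_nat ((Suc m - j) * ((Suc m + j) choose (2 * j)))"
      by (rule arg_cong)
    then have "of_nat (m + j + 1) * C = of_nat (Suc m - j) * D"
      by (simp only: of_nat_mult C_def D_def)
    then show ?thesis
      using True by (simp add: of_nat_diff add_ac)
  next
    case False
    then show ?thesis
      by (simp add: C_def D_def binomial_eq_0)
  qed
  \<comment> \<open>The closed form for \<open>m\<close> is grouped so that \<open>CD\<close> and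
    \<open>AB\<close> turn it into a multiple of \<open>B * D\<close>. What remains is the identity
    (m+1-j)(n+m+2) - (n-j)(2m+3) = -(m+j+2)(n-m-1).\<close>
  have "(of_nat n - of_nat j) * (\<Sum>k\<le>Suc m. (-1) ^ k * of_nat (2 * k + 1) *
           of_nat ((2 * n + 1) choose (n - k)) * of_nat ((k + j) choose (2 * j))) =
        (-1) ^ m * ((of_nat m + of_nat j + 1) * C) * ((of_nat n - of_nat m) * A) -
        (-1) ^ m * (of_nat n - of_nat j) * (2 * of_nat m + 3) * B * D"
    using Suc by (simp add: A_def B_def C_def D_def of_nat_diff algebra_simps)
  also have "\<dots> = - ((-1) ^ m * (of_nat m + of_nat j + 2) * D * (of_nat n - of_nat m - 1) * B)"
    unfolding AB CD by (simp add: algebra_simps)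
  also have "\<dots> = (-1) ^ Suc m * of_nat (Suc m + j + 1) * D * of_nat (n - Suc m) * B"
    using Suc.prems by (simp add: of_nat_diff algebra_simps)
  finally show ?case
    unfolding B_def D_def .
qed

text \<open>At m = n the closed form contains the factor n - m = 0, and for j < n the factor n - j
  cancels in an integral domain of characteristic 0. For j = n the closed form only says 0 = 0, but
  there binom(k+n,2n) kills every term except k = n.\<close>

lemma alternating_ballot_sum_complete:
  assumes "j \<le> n"
  shows "(\<Sum>k\<le>n. (-1) ^ k * of_nat (2 * k + 1) *
           of_nat ((2 * n + 1) choose (n - k)) * of_nat ((k + j) choose (2 * j))) =
         (if j = n then (-1) ^ n * of_nat (2 * n + 1) else (0 :: 'a::{idom, ring_char_0}))"
    (is "(\<Sum>k\<le>n. ?t k) = _")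
proof (cases "j = n")
  case True
  have "(\<Sum>k\<le>n. ?t k) = (\<Sum>k\<in>{n}. ?t k)"
    by (rule sum.mono_neutral_right) (auto simp: True binomial_eq_0)
  then show ?thesis
    by (simp add: True mult_2[symmetric])
next
  case False
  have "(of_nat n - of_nat j) * (\<Sum>k\<le>n. ?t k) = 0"
    using alternating_ballot_sum[of n n j, where ?'a = 'a] by simp
  with False show ?thesis
    by simp
qed

theorem theorem3p4:
  fixes n :: nat
  shows "[:of_nat ((2 * n) choose n):] =
    (\<Sum>k=0..n. smult (of_nat (2 * k + 1) / of_nat (2 * n + 1) * of_nat ((2 * n + 1) choose (n - k)))
                  (narayana_B k * [:1, -1:] ^ (n - k)) :: 'a::field_char_0 poly)"
proof -
  define y :: "'a poly" where "y = [:1, -1:]"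
  define b :: "nat \<Rightarrow> 'a" where
    "b k = of_nat (2 * k + 1) / of_nat (2 * n + 1) * of_nat ((2 * n + 1) choose (n - k))" for k
  define c :: "nat \<Rightarrow> 'a" where "c j = of_nat ((2 * j) choose j)" for j
  define e :: "nat \<Rightarrow> nat \<Rightarrow> 'a" where "e k j = of_nat ((k + j) choose (2 * j))" for k j
  have term_k: "smult (b k) (narayana_B k * y ^ (n - k)) =
      (\<Sum>j\<le>n. smult ((-1) ^ j * c j * ((-1) ^ k * b k * e k j)) (y ^ (n - j)))" if "k \<le> n" for k
  proof -
    have "smult (b k) (narayana_B k * y ^ (n - k)) =
        (\<Sum>j\<le>k. smult (b k * (c j * e k j)) ((- y) ^ (k - j) * y ^ (n - k)))"
      by (simp add: narayana_B_expansion y_def c_def e_def sum_distrib_right smult_sum_right)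
    also have "\<dots> = (\<Sum>j\<le>k. smult ((-1) ^ j * c j * ((-1) ^ k * b k * e k j)) (y ^ (n - j)))"
    proof (intro sum.cong refl)
      fix j assume "j \<in> {..k}"
      then have jk: "j \<le> k" by simp
      \<comment> \<open>As k + j and k - j have the same parity, the sign splits into (-1)^k, which
        makes the sum over \<open>k\<close> alternate, and (-1)^j, which is constant in it.\<close>
      have "(- y) ^ (k - j) = smult ((-1) ^ (k + j)) (y ^ (k - j))"
        using jk by (cases "even (k + j)") (auto simp: even_diff_nat)
      moreover have "y ^ (k - j) * y ^ (n - k) = y ^ (n - j)"
        using jk that by (simp flip: power_add)
      ultimately show "smult (b k * (c j * e k j)) ((- y) ^ (k - j) * y ^ (n - k)) =
          smult ((-1) ^ j * c j * ((-1) ^ k * b k * e k j)) (y ^ (n - j))"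
        by (simp add: power_add mult_ac)
    qed
    \<comment> \<open>For j > k we have 2j > k + j, so \<open>e k j\<close> is 0. The range of
      \<open>j\<close> no longer depends on \<open>k\<close>, and the two sums can be
      exchanged.\<close>
    also have "\<dots> = (\<Sum>j\<le>n. smult ((-1) ^ j * c j * ((-1) ^ k * b k * e k j)) (y ^ (n - j)))"
      by (rule sum.mono_neutral_left) (use that in \<open>auto simp: e_def binomial_eq_0\<close>)
    finally show ?thesis .
  qed
  \<comment> \<open>Up to the sign (-1)^j, this is the factor accompanying \<open>c j\<close> in the
    coefficient of y^(n-j). The denominator 2n+1 in \<open>b\<close> cancels the value at j =
    n.\<close>
  have orthogonality: "(\<Sum>k\<le>n. (-1) ^ k * b k * e k j) = (if j = n then (-1) ^ n else 0)" if "j \<le> n" for j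
  proof -
    have nz: "(of_nat (2 * n + 1) :: 'a) \<noteq> 0"
      by (simp only: of_nat_eq_0_iff)
    have "(\<Sum>k\<le>n. (-1) ^ k * b k * e k j) =
        (\<Sum>k\<le>n. (-1) ^ k * of_nat (2 * k + 1) * of_nat ((2 * n + 1) choose (n - k)) *
           of_nat ((k + j) choose (2 * j))) / of_nat (2 * n + 1)"
      by (simp add: b_def e_def sum_divide_distrib mult.assoc)
    then show ?thesis
      using nz unfolding alternating_ballot_sum_complete[OF that]
      by (auto simp del: of_nat_add of_nat_mult of_nat_Suc)
  qed
  have "(\<Sum>k\<le>n. smult (b k) (narayana_B k * y ^ (n - k))) =
      (\<Sum>k\<le>n. \<Sum>j\<le>n. smult ((-1) ^ j * c j * ((-1) ^ k * b k * e k j)) (y ^ (n - j)))"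
    by (intro sum.cong refl term_k) simp
  also have "\<dots> = (\<Sum>j\<le>n. \<Sum>k\<le>n. smult ((-1) ^ j * c j * ((-1) ^ k * b k * e k j)) (y ^ (n - j)))"
    by (rule sum.swap)
  also have "\<dots> = (\<Sum>j\<le>n. smult ((-1) ^ j * c j * (\<Sum>k\<le>n. (-1) ^ k * b k * e k j)) (y ^ (n - j)))"
    by (simp only: smult_sum sum_distrib_left)
  \<comment> \<open>At j = n the two signs (-1)^n cancel and y^0 = 1, which leaves a constant
    polynomial.\<close>
  also have "\<dots> = (\<Sum>j\<le>n. if j = n then [:c n:] else 0)"
    by (intro sum.cong refl, simp only: orthogonality atMost_iff) (cases "even n"; simp)
  also have "\<dots> = [:c n:]"
    by simp
  finally show ?thesis
    by (simp only: b_def c_def y_def atLeast0AtMost)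
qed

end
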